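(* Let $f,g\in\mathbb{R}[x]\setminus\{0\}$. Suppose that $x$ divides both $f$ and $g$, and that every (complex) zero of each of the polynomials $f$ and $g$ belongs to $(-\infty,0]$. Then every (complex) zero of $f\star g$ also belongs to $(-\infty,0]$.
   Context: The unsigned Lah numbers are $L(n,k)=\frac{n!}{k!}\binom{n-1}{k-1}$ for $1\le k\le n$, with $L(0,0)=1$ and $L(n,k)=0$ otherwise. Let $\mathcal{L}:\mathbb{R}[y]\to\mathbb{R}[x]$ be the linear map determined by $\mathcal{L}(y^n)=\sum_{k=0}^{n}L(n,k)x^k$ for $n\ge 0$. It is a linear isomorphism (its matrix in the monomial bases is unitriangular), with inverse $\mathcal{L}^{-1}(x^n)=\sum_{k=0}^{n}(-1)^{n-k}L(n,k)y^k$. For $f,g\in\mathbb{R}[x]$ the star product is defined by $$f\star g=\mathcal{L}\bigl(\mathcal{L}^{-1}(f)\,\mathcal{L}^{-1}(g)\bigr),$$ where the product inside is the usual product in $\mathbb{R}[y]$. *)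

theory Defs
  imports "HOL-Computational_Algebra.Polynomial" "HOL-Library.Nonpos_Ints"
begin

definition lah :: "nat \<Rightarrow> nat \<Rightarrow> real" where
  "lah n k =
     (if n = 0 \<and> k = 0 then 1
      else if 1 \<le> k \<and> k \<le> n then fact n / fact k * real ((n - 1) choose (k - 1))
      else 0)"

text \<open>
  The linear extension of \<open>y\<^sup>n \<mapsto> \<Sum>k\<le>n. L(n,k) x\<^sup>k\<close>.  Both \<open>\<real>[y]\<close> and \<open>\<real>[x]\<close> are rendered
  as \<open>real poly\<close>.  Lemmas \<open>lah_map_monom\<close>, \<open>lah_map_add\<close>, \<open>lah_map_smult\<close> show that this is
  the intended linear map, and \<open>bij_lah_map\<close> that its \<open>inv\<close> in the star product
  is a genuine two-sided inverse.
\<close>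

definition lah_map :: "real poly \<Rightarrow> real poly" where
  "lah_map p = (\<Sum>n\<le>degree p. smult (coeff p n) (\<Sum>k\<le>n. monom (lah n k) k))"

definition lah_star :: "real poly \<Rightarrow> real poly \<Rightarrow> real poly" (infixl \<open>\<star>\<close> 70) where
  "f \<star> g = lah_map (inv lah_map f * inv lah_map g)"

lemma lah_self: "lah n n = 1"
  by (auto simp: lah_def)

lemma lah_eq_0: "n < k \<Longrightarrow> lah n k = 0"
  by (auto simp: lah_def)

lemma lah_map_altdef:
  assumes "degree p \<le> N"
  shows "lah_map p = (\<Sum>n\<le>N. smult (coeff p n) (\<Sum>k\<le>n. monom (lah n k) k))"
  unfolding lah_map_def using assms
  by (intro sum.mono_neutral_left) (auto simp: coeff_eq_0)

lemma lah_map_add: "lah_map (p + q) = lah_map p + lah_map q"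
proof -
  define N where "N = max (degree p) (degree q)"
  have "degree p \<le> N" "degree q \<le> N" "degree (p + q) \<le> N"
    unfolding N_def by (auto simp: degree_add_le_max)
  then show ?thesis
    by (simp add: lah_map_altdef[of _ N] smult_add_left sum.distrib)
qed

lemma lah_map_smult: "lah_map (smult c p) = smult c (lah_map p)"
proof -
  have "smult c (lah_map p) =
      (\<Sum>n\<le>degree p. smult c (smult (coeff p n) (\<Sum>k\<le>n. monom (lah n k) k)))"
    unfolding lah_map_def by (induction rule: infinite_finite_induct) (auto simp: smult_add_right)
  then show ?thesis
    by (simp add: lah_map_altdef[of "smult c p" "degree p"] degree_smult_le)
qed

lemma lah_map_diff: "lah_map (p - q) = lah_map p - lah_map q"
  using lah_map_add[of "p - q" q] by simp

lemma lah_map_monom: "lah_map (monom 1 n) = (\<Sum>k\<le>n. monom (lah n k) k)"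
proof -
  have "lah_map (monom 1 n) = (\<Sum>m\<le>n. if m = n then (\<Sum>k\<le>m. monom (lah m k) k) else 0)"
    unfolding lah_map_altdef[OF degree_monom_le] by (intro sum.cong) auto
  then show ?thesis by simp
qed

lemma coeff_lah_map: "coeff (lah_map p) i = (\<Sum>n\<le>degree p. coeff p n * lah n i)"
proof -
  have "coeff (\<Sum>k\<le>n. monom (lah n k) k) i = lah n i" for n
    by (auto simp: coeff_sum lah_eq_0)
  then show ?thesis by (simp add: lah_map_def coeff_sum)
qed

lemma degree_lah_map_le: "degree (lah_map p) \<le> degree p"
  by (rule degree_le) (auto simp: coeff_lah_map lah_eq_0)

lemma coeff_lah_map_degree: "coeff (lah_map p) (degree p) = lead_coeff p"
proof -
  have "coeff (lah_map p) (degree p)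
      = (\<Sum>n\<le>degree p. if n = degree p then coeff p n else 0)"
    unfolding coeff_lah_map by (intro sum.cong) (auto simp: lah_self lah_eq_0)
  then show ?thesis by simp
qed

lemma bij_lah_map: "bij lah_map"
proof (rule bijI)
  show "inj lah_map"
  proof (rule injI)
    fix p q assume "lah_map p = lah_map q"
    then have "lah_map (p - q) = 0" by (simp add: lah_map_diff)
    then have "lead_coeff (p - q) = 0" using coeff_lah_map_degree[of "p - q"] by simp
    then show "p = q" by (simp only: leading_coeff_0_iff eq_iff_diff_eq_0[symmetric])
  qed
next
  have "\<exists>p. lah_map p = q" if "degree q < N" for q N
    using that
  proof (induction N arbitrary: q)
    case (Suc N)
    define r where "r = q - lah_map (monom (coeff q N) N)"
    have cN: "coeff (lah_map (monom (coeff q N) N)) N = coeff q N"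
    proof (cases "coeff q N = 0")
      case False
      then show ?thesis
        using coeff_lah_map_degree[of "monom (coeff q N) N"] by (simp add: degree_monom_eq)
    qed (simp add: lah_map_def)
    have "degree (lah_map (monom (coeff q N) N)) \<le> N"
      using degree_lah_map_le degree_monom_le order_trans by blast
    then have dr: "degree r \<le> N" unfolding r_def using Suc.prems by (intro degree_diff_le) auto
    have "\<exists>p. lah_map p = r"
    proof (cases "r = 0")
      case True
      then show ?thesis by (intro exI[of _ 0]) (simp add: lah_map_def)
    next
      case False
      have "coeff r N = 0" using cN by (simp add: r_def)
      with False dr have "degree r < N"
        by (metis leading_coeff_0_iff le_neq_implies_less)
      then show ?thesis by (rule Suc.IH)
    qed
    then obtain p where "lah_map p = r" ..
    then have "lah_map (p + monom (coeff q N) N) = q" by (simp add: lah_map_add r_def)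
    then show ?case ..
  qed simp
  then show "surj lah_map" unfolding surj_def by (metis lessI)
qed

end

theory Submission
  imports Defs "HOL-Computational_Algebra.Fundamental_Theorem_Algebra"
begin

text \<open>
  Transport of multiplication by \<open>y\<close> along \<open>lah_map\<close> gives \<open>x (1 + D)\<^sup>2\<close>, with
  \<open>D\<close> the derivative. Since \<open>\<star>\<close> is multiplication in the variable \<open>y\<close>, this
  operator can be moved freely in and out of the first factor, which yields a three-term
  recurrence in \<open>a\<close> for \<open>x\<^sup>a\<^sup>+\<^sup>1 \<star> x\<^sup>b\<^sup>+\<^sup>1\<close>. Its solution is
  \<open>x (1 + D) k\<^sub>a\<^sub>b\<close>, where
  \<open>k\<^sub>a\<^sub>b = (1 + D)\<^sup>b x\<^sup>a \<cdot> (1 + D)\<^sup>a\<^sup>+\<^sup>1 x\<^sup>b\<^sup>+\<^sup>1\<close>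
  (\<open>lah_star_var_power\<close>). Writing \<open>f = x f\<^sub>1\<close> and \<open>g = x g\<^sub>1\<close>, bilinearity turns this into
  \<open>f \<star> g = x (1 + D) h\<close>, where \<open>h\<close> arises from the coefficients of \<open>f\<^sub>1\<close> and \<open>g\<^sub>1\<close>
  by replacing \<open>x\<^sup>a \<otimes> x\<^sup>b\<close> with \<open>k\<^sub>a\<^sub>b\<close> (\<open>lah_star_eq_star_form\<close>). By a Gauss-Lucas
  argument, \<open>1 + D\<close> keeps all zeros in \<open>(-\<infinity>, 0]\<close>
  (\<open>shift_deriv_nonpos_roots\<close>), so it remains to locate the zeros of \<open>h\<close>.

  A complex number lies outside \<open>(-\<infinity>, 0]\<close> iff it is \<open>t\<^sup>2\<close> with \<open>Re t > 0\<close>. The point of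
  the formula for \<open>k\<^sub>a\<^sub>b\<close> is that, for fixed \<open>t\<close>, the number \<open>h(t\<^sup>2)\<close> is the value at
  \<open>y\<^sub>1 = y\<^sub>2 = t\<close> of
  \<open>(t + \<partial>\<^sub>2) f\<^sub>1((t + \<partial>\<^sub>1)(t + \<partial>\<^sub>2))\<close> applied to \<open>y\<^sub>2 g\<^sub>1(y\<^sub>1 y\<^sub>2)\<close>
  (\<open>poly_star_form\<close>): the operators act on monomials of the two variables separately, and each
  of the resulting factors is, up to a power of \<open>t\<close>, one of the factors of \<open>k\<^sub>a\<^sub>b(t\<^sup>2)\<close>.

  Now \<open>y\<^sub>2 g\<^sub>1(y\<^sub>1 y\<^sub>2)\<close> has no zero with \<open>Re y\<^sub>1 > 0\<close> and \<open>Re y\<^sub>2 > 0\<close>, because a product of two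
  such numbers is never in \<open>(-\<infinity>, 0]\<close>. This property survives \<open>t + \<partial>\<^sub>2\<close>, and also each
  factor \<open>\<alpha> + (t + \<partial>\<^sub>1)(t + \<partial>\<^sub>2)\<close> with \<open>\<alpha> \<ge> 0\<close> into which the zeros of \<open>f\<^sub>1\<close> split the
  operator: for \<open>K = (t + \<partial>\<^sub>2) G\<close>, the logarithmic derivatives of \<open>G\<close> and \<open>K\<close> have nonnegative real part,
  so \<open>K/G\<close> and \<open>(t + \<partial>\<^sub>1) K / K\<close> have positive real part, and then so does
  \<open>\<alpha> G/K + (t + \<partial>\<^sub>1) K / K\<close> (\<open>nonvanishing_linear_factor\<close>). Hence \<open>h(t\<^sup>2) \<noteq> 0\<close>.
\<close>

section \<open>The operators \<open>c + D\<close> on univariate polynomials\<close>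

text \<open>
  A separate constant for the indeterminate prevents the simplifier from rewriting products with
  \<open>[:0, 1:]\<close> to \<open>pCons\<close>, so that operator identities stay ring identities.
\<close>

definition var :: "'a::idom poly" where
  "var = [:0, 1:]"

definition shift_deriv :: "'a::idom \<Rightarrow> 'a poly \<Rightarrow> 'a poly" where
  "shift_deriv c p = smult c p + pderiv p"

lemma pderiv_var [simp]: "pderiv var = 1"
  by (simp add: var_def pderiv_pCons one_pCons)

lemma var_power: "var ^ n = monom 1 n"
  by (simp add: var_def monom_altdef)

lemma poly_var [simp]: "poly var z = z"
  by (simp add: var_def)

lemma shift_deriv_add: "shift_deriv c (p + q) = shift_deriv c p + shift_deriv c q"
  by (simp add: shift_deriv_def smult_add_right pderiv_add)

lemma shift_deriv_diff: "shift_deriv c (p - q) = shift_deriv c p - shift_deriv c q"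
  by (simp add: shift_deriv_def smult_diff_right pderiv_diff)

lemma shift_deriv_0 [simp]: "shift_deriv c 0 = 0"
  by (simp add: shift_deriv_def)

lemma shift_deriv_of_nat_mult: "shift_deriv c (of_nat n * p) = of_nat n * shift_deriv c p"
  by (simp add: shift_deriv_def pderiv_mult distrib_left)

lemma shift_deriv_smult: "shift_deriv c (smult d p) = smult d (shift_deriv c p)"
  by (simp add: shift_deriv_def pderiv_smult smult_add_right mult.commute)

lemma shift_deriv_var_mult: "shift_deriv c (var * p) = var * shift_deriv c p + p"
  by (simp add: shift_deriv_def pderiv_mult distrib_left)

lemma pderiv_shift_deriv_pow:
  "pderiv ((shift_deriv c ^^ n) p) = (shift_deriv c ^^ n) (pderiv p)"
  by (induction n) (simp_all add: shift_deriv_def pderiv_add pderiv_smult)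

lemma shift_deriv_pow_of_nat_mult:
  "(shift_deriv c ^^ n) (of_nat m * p) = of_nat m * (shift_deriv c ^^ n) p"
  by (induction n) (simp_all add: shift_deriv_of_nat_mult)

lemma of_nat_mult_shift_deriv_pow:
  "of_nat n * shift_deriv c ((shift_deriv c ^^ (n - 1)) p) = of_nat n * (shift_deriv c ^^ n) p"
  by (cases n) simp_all

text \<open>The Weyl relation, iterated: the commutator of \<open>c + D\<close> and multiplication by \<open>x\<close> is \<open>1\<close>.\<close>

lemma shift_deriv_pow_var_mult:
  "(shift_deriv c ^^ n) (var * p) =
     var * (shift_deriv c ^^ n) p + of_nat n * (shift_deriv c ^^ (n - 1)) p"
proof (induction n)
  case (Suc n)
  show ?case
    using of_nat_mult_shift_deriv_pow[of n c p]
    by (simp add: Suc shift_deriv_add shift_deriv_var_mult shift_deriv_of_nat_mult algebra_simps)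
qed simp

section \<open>The polynomials \<open>(1 + D)\<^sup>n x\<^sup>m\<close>\<close>

text \<open>
  Explicitly \<open>\<Sum>i. i! (n choose i) (m choose i) x\<^sup>m\<^sup>-\<^sup>i\<close>, a Laguerre polynomial at a negated
  argument up to normalization; its coefficients are the rook numbers of an \<open>n\<close> by \<open>m\<close> board.
\<close>

definition shifted_power :: "nat \<Rightarrow> nat \<Rightarrow> 'a::idom poly" where
  "shifted_power n m = (shift_deriv 1 ^^ n) (var ^ m)"

lemma shifted_power_0 [simp]: "shifted_power 0 m = var ^ m"
  by (simp add: shifted_power_def)

lemma shifted_power_Suc_left:
  "shifted_power (Suc n) m = shifted_power n m + pderiv (shifted_power n m)"
  by (simp add: shifted_power_def shift_deriv_def)

lemma shifted_power_Suc_right: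
  "shifted_power n (Suc m) = var * shifted_power n m + of_nat n * shifted_power (n - 1) m"
  by (simp add: shifted_power_def shift_deriv_pow_var_mult)

lemma pderiv_var_power: "pderiv (var ^ m :: 'a::idom poly) = of_nat m * var ^ (m - 1)"
  by (cases m)
     (simp_all add: pderiv_power_Suc of_nat_poly del: of_nat_Suc power_Suc mult_cancel_right)

lemma pderiv_shifted_power: "pderiv (shifted_power n m) = of_nat m * shifted_power n (m - 1)"
  by (simp add: shifted_power_def pderiv_shift_deriv_pow pderiv_var_power shift_deriv_pow_of_nat_mult)

lemma shifted_power_0_right [simp]: "shifted_power n 0 = 1"
  by (induction n) (simp_all add: shifted_power_Suc_left)

text \<open>
  For \<open>n = 0\<close> this is the Euler identity for \<open>x\<^sup>m\<close>; applying \<open>1 + D\<close> to the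
  identity for \<open>n\<close> gives the one for \<open>n + 1\<close>. For \<open>n = 0\<close> the truncated \<open>n - 1\<close> is harmless
  because of the factor \<open>n\<close>.
\<close>

lemma shifted_power_lower:
  "of_nat n * shifted_power (n - 1) m
     = var * pderiv (shifted_power n m) + of_nat n * shifted_power n m - of_nat m * shifted_power n m"
proof (induction n)
  case 0
  have "var * pderiv (shifted_power 0 m :: 'a poly) = of_nat m * shifted_power 0 m"
    unfolding pderiv_shifted_power by (cases m) (simp_all del: of_nat_Suc)
  then show ?case by simp
next
  case (Suc n)
  have "(of_nat n * shifted_power n m :: 'a poly) = shift_deriv 1 (of_nat n * shifted_power (n - 1) m)"
    by (cases n) (simp_all add: shifted_power_def shift_deriv_of_nat_mult del: of_nat_Suc)
  also have "\<dots> = var * shift_deriv 1 (pderiv (shifted_power n m)) + pderiv (shifted_power n m)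
      + of_nat n * shifted_power (Suc n) m - of_nat m * shifted_power (Suc n) m"
    unfolding Suc unfolding shift_deriv_diff shift_deriv_add shift_deriv_of_nat_mult shift_deriv_var_mult
    by (simp add: shifted_power_def)
  also have "shift_deriv 1 (pderiv (shifted_power n m)) = pderiv (shifted_power (Suc n) m)"
    by (simp add: shift_deriv_def shifted_power_Suc_left pderiv_add)
  also have "pderiv (shifted_power n m) = shifted_power (Suc n) m - shifted_power n m"
    by (simp add: shifted_power_Suc_left)
  finally show ?case by (simp add: algebra_simps)
qed

text \<open>
  Laguerre's differential equation: applying \<open>1 + D\<close> to \<open>shifted_power_lower\<close> turns the left-hand
  side back into \<open>n (1 + D)\<^sup>n x\<^sup>m\<close>.
\<close>

lemma shifted_power_ode:
  "var * pderiv (pderiv (shifted_power n m)) + var * pderiv (shifted_power n m)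
     + (1 + of_nat n - of_nat m) * pderiv (shifted_power n m) - of_nat m * shifted_power n m = 0"
proof -
  have "(of_nat n * shifted_power n m :: 'a poly) = shift_deriv 1 (of_nat n * shifted_power (n - 1) m)"
    by (cases n) (simp_all add: shifted_power_def shift_deriv_of_nat_mult del: of_nat_Suc)
  also have "\<dots> = var * shift_deriv 1 (pderiv (shifted_power n m)) + pderiv (shifted_power n m)
      + of_nat n * shift_deriv 1 (shifted_power n m) - of_nat m * shift_deriv 1 (shifted_power n m)"
    unfolding shifted_power_lower shift_deriv_diff shift_deriv_add shift_deriv_of_nat_mult
      shift_deriv_var_mult by simp
  finally show ?thesis by (simp add: shift_deriv_def algebra_simps eq_commute)
qed

section \<open>The kernel of the star product\<close>

definition star_kernel :: "nat \<Rightarrow> nat \<Rightarrow> 'a::idom poly" where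
  "star_kernel a b = shifted_power b a * shifted_power (Suc a) (Suc b)"

text \<open>
  This is the recurrence that \<open>\<star>\<close> forces on the kernel. Raising and lowering \<open>a\<close> in either factor is
  a first-order differential operator, so both sides are expressions in the two factors \<open>p\<close>, \<open>q\<close> and
  their derivatives; their difference is \<open>q\<close> times the differential equation of \<open>p\<close> plus \<open>p\<close> times
  the one of \<open>q\<close>.
\<close>

lemma star_kernel_recurrence:
  "shift_deriv 1 (var * shift_deriv 1 (star_kernel a b))
     = star_kernel (Suc a) b + 2 * of_nat (Suc a) * star_kernel a b
       + of_nat a * of_nat (Suc a) * star_kernel (a - 1) b"
proof -
  define p q :: "'a poly" where "p = shifted_power b a" and "q = shifted_power (Suc a) (Suc b)"
  have raise: "shifted_power b (Suc a) = var * p + var * pderiv p + of_nat b * p - of_nat a * p"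
    unfolding shifted_power_Suc_right shifted_power_lower p_def by simp
  have raise': "shifted_power (Suc (Suc a)) (Suc b) = q + pderiv q"
    by (simp add: q_def shifted_power_Suc_left)
  have lower: "of_nat a * shifted_power b (a - 1) = pderiv p"
    by (simp add: p_def pderiv_shifted_power)
  have lower': "of_nat (Suc a) * shifted_power a (Suc b)
      = var * pderiv q + of_nat a * q - of_nat b * q"
    using shifted_power_lower[of "Suc a" "Suc b", where ?'a = 'a] by (simp add: q_def algebra_simps)
  have "of_nat a * of_nat (Suc a) * star_kernel (a - 1) b
      = (of_nat a * shifted_power b (a - 1)) * (of_nat (Suc a) * shifted_power a (Suc b) :: 'a poly)"
    by (cases a) (simp_all add: star_kernel_def algebra_simps)
  then have k_lower: "of_nat a * of_nat (Suc a) * star_kernel (a - 1) b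
      = pderiv p * (var * pderiv q + of_nat a * q - of_nat b * q)"
    unfolding lower lower' .
  have k_raise: "star_kernel (Suc a) b =
      (var * p + var * pderiv p + of_nat b * p - of_nat a * p) * (q + pderiv q)"
    unfolding star_kernel_def raise raise' ..
  have k: "star_kernel a b = p * q" by (simp add: star_kernel_def p_def q_def)
  have ode_p: "var * pderiv (pderiv p) + var * pderiv p
      + (1 + of_nat b - of_nat a) * pderiv p - of_nat a * p = 0"
    unfolding p_def by (rule shifted_power_ode)
  have ode_q: "var * pderiv (pderiv q) + var * pderiv q
      + (1 + of_nat a - of_nat b) * pderiv q - (1 + of_nat b) * q = 0"
    using shifted_power_ode[of "Suc a" "Suc b", where ?'a = 'a] unfolding q_def
    by (simp add: add_diff_eq)
  have "shift_deriv 1 (var * shift_deriv 1 (p * q)) -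
      ((var * p + var * pderiv p + of_nat b * p - of_nat a * p) * (q + pderiv q)
       + 2 * (1 + of_nat a) * (p * q) + pderiv p * (var * pderiv q + of_nat a * q - of_nat b * q))
     = q * (var * pderiv (pderiv p) + var * pderiv p
          + (1 + of_nat b - of_nat a) * pderiv p - of_nat a * p)
       + p * (var * pderiv (pderiv q) + var * pderiv q
          + (1 + of_nat a - of_nat b) * pderiv q - (1 + of_nat b) * q)"
    by (simp add: shift_deriv_def pderiv_mult pderiv_add algebra_simps)
  then show ?thesis unfolding k k_raise k_lower ode_p ode_q by simp
qed

section \<open>The star product of monomials\<close>

lemma lah_Suc_Suc: "lah (Suc m) (Suc j) = fact (Suc m) / fact (Suc j) * real (m choose j)"
  by (simp add: lah_def binomial_eq_0)

text \<open>
  The coefficient form of \<open>x (1 + D)\<^sup>2 = x + 2 x D + x D\<^sup>2\<close>. After cancelling factorials, it is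
  Pascal's rule applied twice together with the absorption identity for binomial coefficients.
\<close>

lemma lah_recurrence:
  "lah (Suc n) k =
     (if k = 0 then 0 else lah n (k - 1)) + 2 * real k * lah n k
       + real k * real (Suc k) * lah n (Suc k)"
proof (cases n)
  case 0
  then show ?thesis by (cases "k = 1") (auto simp: lah_def)
next
  case n: (Suc m)
  consider "k = 0" | "k = 1" | i where "k = Suc (Suc i)"
    by (metis One_nat_def not0_implies_Suc)
  then show ?thesis
  proof cases
    case 1
    then show ?thesis by (simp add: lah_def)
  next
    case 2
    have "lah n 0 = 0" "lah n 1 = fact n"
      by (simp_all add: n lah_def del: fact_Suc)
    moreover have "lah n (Suc (Suc 0)) = fact n / 2 * real m"
      unfolding n lah_Suc_Suc by simp
    moreover have "lah (Suc n) 1 = (real m + 2) * fact n"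
      using lah_Suc_Suc[of n 0] by (simp add: n)
    ultimately show ?thesis unfolding 2 by (simp add: algebra_simps del: fact_Suc)
  next
    case (3 i)
    let ?A = "real (m choose i)" and ?B = "real (m choose Suc i)"
      and ?C = "real (m choose Suc (Suc i))"
    have "Suc (Suc m) * (Suc m choose Suc i)
        = Suc (Suc i) * ((m choose i) + 2 * (m choose Suc i) + (m choose Suc (Suc i)))"
      unfolding Suc_times_binomial[symmetric] by (simp only: binomial_Suc_Suc) simp
    then have "real (Suc (Suc m) * (Suc m choose Suc i))
        = real (Suc (Suc i) * ((m choose i) + 2 * (m choose Suc i) + (m choose Suc (Suc i))))"
      by (rule arg_cong)
    then have absorb: "real (Suc (Suc m)) * real (Suc m choose Suc i)
        = real (Suc (Suc i)) * (?A + 2 * ?B + ?C)"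
      by (simp only: of_nat_mult of_nat_add of_nat_numeral)
    have split: "u * (k * (x + 2 * y + z)) / (k * v)
        = u / v * x + 2 * k * (u / (k * v) * y) + k * l * (u / (l * (k * v)) * z)"
      if "k \<noteq> 0" "l \<noteq> 0" "v \<noteq> 0" for u v x y z k l :: real
      using that by (simp add: field_simps)
    have "lah (Suc n) k = fact (Suc m) * (real (Suc (Suc m)) * real (Suc m choose Suc i))
        / (real (Suc (Suc i)) * fact (Suc i))"
      unfolding n 3 lah_Suc_Suc fact_Suc[of "Suc m"] fact_Suc[of "Suc i"]
      by (simp only: times_divide_eq_left times_divide_eq_right mult_ac of_nat_id)
    also have "\<dots> = lah n (k - 1) + 2 * real k * lah n k + real k * real (Suc k) * lah n (Suc k)"
      unfolding absorb n 3 lah_Suc_Suc fact_Suc[of "Suc (Suc i)"] fact_Suc[of "Suc i"]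
        diff_Suc_1 of_nat_id
      by (rule split) simp_all
    finally show ?thesis by (simp only: 3 nat.distinct if_False)
  qed
qed

lemma coeff_lah_map_le:
  assumes "degree p \<le> N"
  shows "coeff (lah_map p) i = (\<Sum>n\<le>N. coeff p n * lah n i)"
  unfolding coeff_lah_map using assms
  by (intro sum.mono_neutral_left) (auto simp: coeff_eq_0)

lemma lah_map_var_mult: "lah_map (var * p) = var * shift_deriv 1 (shift_deriv 1 (lah_map p))"
proof (rule poly_eqI)
  fix i
  define N where "N = degree p"
  define c where "c = coeff (lah_map p)"
  have c: "c k = (\<Sum>n\<le>N. coeff p n * lah n k)" for k
    unfolding c_def N_def by (rule coeff_lah_map)
  have "degree (var * p) \<le> Suc N" by (simp add: var_def N_def degree_pCons_le)
  then have "coeff (lah_map (var * p)) i = (\<Sum>n\<le>Suc N. coeff (var * p) n * lah n i)"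
    by (rule coeff_lah_map_le)
  also have "\<dots> = (\<Sum>n\<le>N. coeff p n * lah (Suc n) i)"
    by (simp add: sum.atMost_Suc_shift var_def del: sum.atMost_Suc)
  also have "\<dots> = (if i = 0 then 0 else c (i - 1)) + 2 * real i * c i
      + real i * real (Suc i) * c (Suc i)"
    unfolding lah_recurrence c
    by (simp add: sum.distrib sum_distrib_left algebra_simps)
  also have "\<dots> = coeff (var * shift_deriv 1 (shift_deriv 1 (lah_map p))) i"
    by (cases i) (simp_all add: c_def var_def shift_deriv_def coeff_pderiv pderiv_add
        numeral_poly algebra_simps)
  finally show "coeff (lah_map (var * p)) i
      = coeff (var * shift_deriv 1 (shift_deriv 1 (lah_map p))) i" .
qed

text \<open>
  On the other side of \<open>lah_map\<close> the operator is multiplication by \<open>y\<close>, so the claim is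
  associativity of the ordinary product.
\<close>

lemma lah_star_shift:
  "(var * shift_deriv 1 (shift_deriv 1 f)) \<star> g = var * shift_deriv 1 (shift_deriv 1 (f \<star> g))"
proof -
  have inv1: "inv lah_map (lah_map p) = p" and inv2: "lah_map (inv lah_map p) = p" for p
    using bij_lah_map by (simp_all add: bij_is_inj bij_is_surj surj_f_inv_f)
  have "inv lah_map (var * shift_deriv 1 (shift_deriv 1 f)) = var * inv lah_map f"
    using inv1[of "var * inv lah_map f"] by (simp add: lah_map_var_mult inv2)
  then show ?thesis by (simp add: lah_star_def mult.assoc lah_map_var_mult)
qed

lemma one_lah_star: "1 \<star> g = g"
proof -
  have "lah_map 1 = 1" by (simp add: lah_map_def lah_self)
  then have "inv lah_map 1 = 1" using bij_lah_map by (metis bij_is_inj inv_f_f)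
  then show ?thesis
    using bij_lah_map by (simp add: lah_star_def bij_is_surj surj_f_inv_f)
qed

lemma inv_lah_map_add: "inv lah_map (p + q) = inv lah_map p + inv lah_map q"
  using bij_lah_map by (metis bij_is_inj bij_is_surj inv_f_f lah_map_add surj_f_inv_f)

lemma inv_lah_map_smult: "inv lah_map (smult c p) = smult c (inv lah_map p)"
  using bij_lah_map by (metis bij_is_inj bij_is_surj inv_f_f lah_map_smult surj_f_inv_f)

lemma lah_star_commute: "f \<star> g = g \<star> f"
  by (simp add: lah_star_def mult.commute)

lemma lah_star_add_left: "(f + f') \<star> g = f \<star> g + f' \<star> g"
  by (simp add: lah_star_def inv_lah_map_add distrib_right lah_map_add)

lemma lah_star_smult_left: "smult c f \<star> g = smult c (f \<star> g)"
  by (simp add: lah_star_def inv_lah_map_smult lah_map_smult)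

lemma lah_star_sum_left:
  "(\<Sum>i\<in>A. smult (c i) (F i)) \<star> g = (\<Sum>i\<in>A. smult (c i) (F i \<star> g))"
proof (induction A rule: infinite_finite_induct)
  case (insert i A)
  then show ?case by (simp add: lah_star_add_left lah_star_smult_left)
qed (use lah_star_smult_left[of 0 0 g] in simp_all)

lemma lah_star_sum_right:
  "g \<star> (\<Sum>i\<in>A. smult (c i) (F i)) = (\<Sum>i\<in>A. smult (c i) (g \<star> F i))"
  using lah_star_sum_left[of c F A g] by (simp add: lah_star_commute)

lemma lah_star_of_nat_mult_left: "(of_nat n * f) \<star> g = of_nat n * (f \<star> g)"
  using lah_star_smult_left[of "of_nat n" f g] by (simp add: of_nat_poly)

text \<open>
  Moving \<open>T = x (1 + D)\<^sup>2\<close> out of the first factor of \<open>T x\<^sup>c\<^sup>+\<^sup>1 \<star> x\<^sup>b\<^sup>+\<^sup>1\<close> and expanding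
  \<open>T x\<^sup>c\<^sup>+\<^sup>1 = x\<^sup>c\<^sup>+\<^sup>2 + 2 (c + 1) x\<^sup>c\<^sup>+\<^sup>1 + c (c + 1) x\<^sup>c\<close> expresses the product for \<open>c + 2\<close> through
  those for \<open>c + 1\<close> and \<open>c\<close>. The right-hand side obeys the same recurrence, because
  \<open>T x (1 + D) = x (1 + D) \<cdot> (1 + D) x (1 + D)\<close> and \<open>star_kernel_recurrence\<close> evaluates the last factor.
\<close>

lemma lah_star_var_power:
  "var ^ Suc a \<star> var ^ Suc b = var * shift_deriv 1 (star_kernel a b)"
proof (induction a rule: less_induct)
  case (less a)
  define S where "S k = var ^ k \<star> var ^ Suc b" for k
  define T :: "real poly \<Rightarrow> real poly" where "T p = var * shift_deriv 1 (shift_deriv 1 p)" for p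
  have T_star: "T f \<star> g = T (f \<star> g)" for f g
    unfolding T_def by (rule lah_star_shift)
  show ?case
  proof (cases a)
    case 0
    have "var ^ Suc a = T 1"
      by (simp add: 0 T_def shift_deriv_def)
    then have "var ^ Suc a \<star> var ^ Suc b = T (var ^ Suc b)"
      by (simp only: T_star one_lah_star)
    also have "\<dots> = var * shift_deriv 1 (star_kernel a b)"
      unfolding T_def 0 star_kernel_def shifted_power_0_right by (simp add: shifted_power_def)
    finally show ?thesis .
  next
    case (Suc c)
    have "T (var ^ Suc c) = var ^ Suc (Suc c) + of_nat (2 * Suc c) * var ^ Suc c
        + of_nat (c * Suc c) * var ^ c"
    proof -
      have D: "pderiv (var ^ Suc c :: real poly) = of_nat (Suc c) * var ^ c"
        unfolding pderiv_var_power by simp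
      have DD: "var * pderiv (var ^ c :: real poly) = of_nat c * var ^ c"
        unfolding pderiv_var_power by (cases c) (simp_all del: of_nat_Suc)
      have "T (var ^ Suc c) = var * var ^ Suc c + 2 * (var * pderiv (var ^ Suc c))
          + var * pderiv (pderiv (var ^ Suc c))"
        by (simp add: T_def shift_deriv_def pderiv_add algebra_simps)
      also have "pderiv (pderiv (var ^ Suc c :: real poly)) = of_nat (Suc c) * pderiv (var ^ c)"
        unfolding D by (simp add: pderiv_mult pderiv_add del: of_nat_Suc)
      also have "var * (of_nat (Suc c) * pderiv (var ^ c :: real poly))
          = of_nat (Suc c) * (of_nat c * var ^ c)"
        unfolding DD[symmetric] by (simp only: mult_ac)
      finally show ?thesis unfolding D by (simp only: power_Suc of_nat_mult of_nat_numeral mult_ac)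
    qed
    then have "T (S (Suc c))
        = S (Suc a) + of_nat (2 * Suc c) * S (Suc c) + of_nat (c * Suc c) * S c"
      unfolding Suc S_def T_star[symmetric]
      by (simp only: lah_star_add_left lah_star_of_nat_mult_left)
    moreover have S_c: "S (Suc c) = var * shift_deriv 1 (star_kernel c b)"
      unfolding S_def by (rule less.IH) (simp add: Suc)
    \<comment> \<open>The exponent \<open>0\<close> is outside the range of the claim, but then the coefficient vanishes.\<close>
    moreover have "of_nat (c * Suc c) * S c
        = of_nat (c * Suc c) * (var * shift_deriv 1 (star_kernel (c - 1) b))"
    proof (cases c)
      case (Suc d)
      then show ?thesis
        unfolding S_def using less.IH[of d] \<open>a = Suc c\<close> by simp
    qed simp
    moreover have "T (var * shift_deriv 1 (star_kernel c b)) = var * shift_deriv 1 (star_kernel a b)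
        + of_nat (2 * Suc c) * (var * shift_deriv 1 (star_kernel c b))
        + of_nat (c * Suc c) * (var * shift_deriv 1 (star_kernel (c - 1) b))"
    proof -
      have "shift_deriv 1 (var * shift_deriv 1 (star_kernel c b) :: real poly)
          = star_kernel a b + of_nat (2 * Suc c) * star_kernel c b
            + of_nat (c * Suc c) * star_kernel (c - 1) b"
        unfolding star_kernel_recurrence Suc by (simp only: of_nat_mult of_nat_numeral)
      then show ?thesis
        unfolding T_def
        by (simp only: shift_deriv_add shift_deriv_of_nat_mult distrib_left mult.left_commute)
    qed
    ultimately have "S (Suc a) + of_nat (2 * Suc c) * (var * shift_deriv 1 (star_kernel c b))
          + of_nat (c * Suc c) * (var * shift_deriv 1 (star_kernel (c - 1) b))
        = var * shift_deriv 1 (star_kernel a b)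
          + of_nat (2 * Suc c) * (var * shift_deriv 1 (star_kernel c b))
          + of_nat (c * Suc c) * (var * shift_deriv 1 (star_kernel (c - 1) b))"
      by (simp only:)
    then show ?thesis by (simp only: S_def add_right_cancel)
  qed
qed

section \<open>Bilinear expansion of the star product\<close>

definition star_form :: "'a::idom poly \<Rightarrow> 'a poly \<Rightarrow> 'a poly" where
  "star_form f g = (\<Sum>a\<le>degree f. smult (coeff f a)
     (\<Sum>b\<le>degree g. smult (coeff g b) (star_kernel a b)))"

lemma lah_star_eq_star_form:
  "(var * f) \<star> (var * g) = var * shift_deriv 1 (star_form f g)"
proof -
  have expand: "var * p = (\<Sum>a\<le>degree p. smult (coeff p a) (var ^ Suc a))" for p :: "real poly"
  proof -
    have "p = (\<Sum>a\<le>degree p. smult (coeff p a) (var ^ a))"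
      by (simp add: var_power smult_monom poly_as_sum_of_monoms)
    then have "var * p = var * (\<Sum>a\<le>degree p. smult (coeff p a) (var ^ a))" by (rule arg_cong)
    then show ?thesis by (simp add: sum_distrib_left)
  qed
  have shift_sum: "var * shift_deriv 1 (\<Sum>i\<in>A. smult (c i) (p i))
      = (\<Sum>i\<in>A. smult (c i) (var * shift_deriv 1 (p i)))"
    for A :: "nat set" and c and p :: "nat \<Rightarrow> real poly"
    by (induction A rule: infinite_finite_induct)
       (simp_all add: shift_deriv_add shift_deriv_smult distrib_left)
  have "(var * f) \<star> (var * g)
      = (\<Sum>a\<le>degree f. smult (coeff f a) (var ^ Suc a \<star> (var * g)))"
    by (subst expand[of f]) (rule lah_star_sum_left)
  also have "\<dots> = (\<Sum>a\<le>degree f. smult (coeff f a)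
      (\<Sum>b\<le>degree g. smult (coeff g b) (var ^ Suc a \<star> var ^ Suc b)))"
    by (subst expand[of g]) (simp only: lah_star_sum_right)
  also have "\<dots> = var * shift_deriv 1 (star_form f g)"
    unfolding star_form_def shift_sum lah_star_var_power ..
  finally show ?thesis .
qed

section \<open>Logarithmic derivatives\<close>

lemma degree_linear_mult:
  fixes q :: "'a::idom poly"
  assumes "q \<noteq> 0"
  shows "degree ([:-r, 1:] * q) = Suc (degree q)"
  using assms by (subst degree_mult_eq) auto

text \<open>
  Because \<open>p'/p\<close> at \<open>z\<close> is the sum of \<open>1/(z - r)\<close> over the zeros \<open>r\<close> of \<open>p\<close>,
  with multiplicity. The weight \<open>w\<close> rotates the
  half-plane: \<open>w = 1\<close> serves for zeros in the left half-plane and \<open>w = \<surd>z\<close> for zeros in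
  \<open>(-\<infinity>, 0]\<close>.
\<close>

lemma Re_log_deriv_nonneg:
  fixes p :: "complex poly"
  assumes "\<And>r. poly p r = 0 \<Longrightarrow> Re (w / (z - r)) \<ge> 0" and "poly p z \<noteq> 0"
  shows "Re (w * (poly (pderiv p) z / poly p z)) \<ge> 0"
  using assms
proof (induction "degree p" arbitrary: p)
  case 0
  then have "pderiv p = 0" by (simp add: pderiv_eq_0_iff)
  then show ?case by simp
next
  case (Suc n)
  then have "\<not> constant (poly p)" by (simp add: constant_degree)
  then obtain r where r: "poly p r = 0" using fundamental_theorem_of_algebra by blast
  then obtain q where p: "p = [:-r, 1:] * q" by (auto simp: poly_eq_0_iff_dvd elim: dvdE)
  have "p \<noteq> 0" using Suc.prems by auto
  then have "q \<noteq> 0" by (auto simp: p)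
  then have "degree q = n" using Suc.hyps(2) degree_linear_mult[of q r] unfolding p by (metis nat.inject)
  moreover have q: "poly q z \<noteq> 0" and "z \<noteq> r" using Suc.prems by (auto simp: p)
  ultimately have *: "Re (w * (poly (pderiv q) z / poly q z)) \<ge> 0"
    by (intro Suc.hyps Suc.prems) (auto simp: p)
  have **: "Re (w / (z - r)) \<ge> 0" using r by (rule Suc.prems)
  have "poly (pderiv p) z = poly q z + (z - r) * poly (pderiv q) z"
    unfolding p pderiv_mult by (simp add: pderiv_pCons algebra_simps)
  moreover have "poly p z = (z - r) * poly q z"
    unfolding p by (simp add: algebra_simps)
  ultimately have "w * (poly (pderiv p) z / poly p z)
      = w / (z - r) + w * (poly (pderiv q) z / poly q z)"
    using q \<open>z \<noteq> r\<close> by (simp only:) (simp add: field_simps)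
  with * ** show ?case by simp
qed

lemma Re_csqrt_pos: "z \<notin> \<real>\<^sub>\<le>\<^sub>0 \<Longrightarrow> Re (csqrt z) > 0"
proof (rule ccontr)
  assume z: "z \<notin> \<real>\<^sub>\<le>\<^sub>0" and "\<not> Re (csqrt z) > 0"
  then have "Re (csqrt z) = 0" using Re_csqrt[of z] by linarith
  then have "Re ((csqrt z)\<^sup>2) \<le> 0" "Im ((csqrt z)\<^sup>2) = 0"
    by (simp_all only: Re_power2 Im_power2) simp_all
  then show False using z by (simp add: complex_nonpos_Reals_iff)
qed

text \<open>
  At a zero of \<open>h + h'\<close> that is not a zero of \<open>h\<close> one has \<open>h'/h = -1\<close>. For \<open>Re t > 0\<close> and \<open>s \<le> 0\<close> the
  number \<open>t/(t\<^sup>2 - s)\<close> has nonnegative real part, whereas \<open>t \<cdot> (-1)\<close> does not.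
\<close>

lemma shift_deriv_nonpos_roots:
  fixes h :: "complex poly"
  assumes roots: "\<And>r. poly h r = 0 \<Longrightarrow> r \<in> \<real>\<^sub>\<le>\<^sub>0" and z: "poly (shift_deriv 1 h) z = 0"
  shows "z \<in> \<real>\<^sub>\<le>\<^sub>0"
proof (rule ccontr)
  assume "z \<notin> \<real>\<^sub>\<le>\<^sub>0"
  define t where "t = csqrt z"
  have t: "Re t > 0" "z = t\<^sup>2" using Re_csqrt_pos[OF \<open>z \<notin> \<real>\<^sub>\<le>\<^sub>0\<close>] by (simp_all add: t_def)
  have hz: "poly h z \<noteq> 0" using roots \<open>z \<notin> \<real>\<^sub>\<le>\<^sub>0\<close> by blast
  have "Re (t * (poly (pderiv h) z / poly h z)) \<ge> 0"
  proof (rule Re_log_deriv_nonneg[OF _ hz])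
    fix r assume "poly h r = 0"
    then obtain s where s: "r = of_real s" "s \<le> 0" using roots by (blast elim: nonpos_Reals_cases)
    have "Re (t * cnj (t\<^sup>2 - of_real s)) = Re t * ((cmod t)\<^sup>2 - s)"
      by (simp add: Re_power2 Im_power2 cmod_power2) (simp add: power2_eq_square algebra_simps)
    moreover have "Re (t / (z - r)) = Re (t * cnj (t\<^sup>2 - of_real s)) / (cmod (t\<^sup>2 - of_real s))\<^sup>2"
      unfolding t(2) s(1) by (metis Re_divide_of_real complex_div_cnj of_real_power)
    moreover have "(cmod t)\<^sup>2 - s \<ge> 0"
      using s(2) zero_le_power2[of "cmod t"] by linarith
    ultimately show "Re (t / (z - r)) \<ge> 0"
      using t(1) by (simp only: divide_nonneg_nonneg mult_nonneg_nonneg less_imp_le zero_le_power2)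
  qed
  moreover have "poly (pderiv h) z / poly h z = - 1"
    using z hz by (simp add: shift_deriv_def field_simps add_eq_0_iff)
  ultimately have "Re (t * - 1) \<ge> 0" by (simp only:)
  then show False using t by simp
qed

lemma Re_shift_deriv_quotient:
  fixes p :: "complex poly"
  assumes roots: "\<And>r. Re r > 0 \<Longrightarrow> poly p r \<noteq> 0" and "Re y > 0"
  shows "Re (poly (shift_deriv t p) y / poly p y) \<ge> Re t"
proof -
  have y: "poly p y \<noteq> 0" using assms by blast
  have "Re (1 * (poly (pderiv p) y / poly p y)) \<ge> 0"
  proof (rule Re_log_deriv_nonneg)
    fix r assume "poly p r = 0"
    then have "Re r \<le> 0" using roots not_le by blast
    with \<open>Re y > 0\<close> show "Re (1 / (y - r)) \<ge> 0"
      by (simp add: Re_divide)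
  qed (rule y)
  then show ?thesis using y by (simp add: shift_deriv_def add_divide_distrib)
qed

section \<open>Bivariate polynomials without zeros in a product of half-planes\<close>

text \<open>
  A bivariate polynomial is a polynomial in the outer variable \<open>y\<^sub>2\<close> with coefficients in the
  inner variable \<open>y\<^sub>1\<close>.
\<close>

definition bieval :: "complex poly poly \<Rightarrow> complex \<Rightarrow> complex \<Rightarrow> complex" where
  "bieval G y1 y2 = poly (poly G [:y2:]) y1"

definition shift_inner :: "complex \<Rightarrow> complex poly poly \<Rightarrow> complex poly poly" where
  "shift_inner t G = map_poly (shift_deriv t) G"

definition shift_outer :: "complex \<Rightarrow> complex poly poly \<Rightarrow> complex poly poly" where
  "shift_outer t G = shift_deriv [:t:] G"

definition shift_both :: "complex \<Rightarrow> complex poly poly \<Rightarrow> complex poly poly" where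
  "shift_both t G = shift_inner t (shift_outer t G)"

definition nonvanishing :: "complex poly poly \<Rightarrow> bool" where
  "nonvanishing G \<longleftrightarrow> (\<forall>y1 y2. Re y1 > 0 \<longrightarrow> Re y2 > 0 \<longrightarrow> bieval G y1 y2 \<noteq> 0)"

lemma bieval_add: "bieval (G + H) y1 y2 = bieval G y1 y2 + bieval H y1 y2"
  by (simp add: bieval_def)

lemma bieval_smult: "bieval (smult [:c:] G) y1 y2 = c * bieval G y1 y2"
  by (simp add: bieval_def)

lemma bieval_sum: "bieval (\<Sum>i\<in>A. G i) y1 y2 = (\<Sum>i\<in>A. bieval (G i) y1 y2)"
  by (simp add: bieval_def poly_sum)

lemma coeff_shift_inner: "coeff (shift_inner t G) n = shift_deriv t (coeff G n)"
  by (simp add: shift_inner_def coeff_map_poly)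

lemma bieval_shift_inner: "bieval (shift_inner t G) y1 y2 = poly (shift_deriv t (poly G [:y2:])) y1"
proof -
  have "poly (shift_inner t G) [:y2:] = shift_deriv t (poly G [:y2:])"
    by (induction G)
       (simp_all add: shift_inner_def map_poly_pCons shift_deriv_add shift_deriv_smult)
  then show ?thesis by (simp add: bieval_def)
qed

text \<open>
  Fixing the inner variable gives a univariate polynomial in the outer one, to which the results
  on logarithmic derivatives apply.
\<close>

definition outer_slice :: "complex \<Rightarrow> complex poly poly \<Rightarrow> complex poly" where
  "outer_slice y1 G = map_poly (\<lambda>c. poly c y1) G"

lemma poly_outer_slice: "poly (outer_slice y1 G) y2 = bieval G y1 y2"
  by (induction G) (simp_all add: outer_slice_def bieval_def map_poly_pCons)

lemma bieval_shift_outer: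
  "bieval (shift_outer t G) y1 y2 = poly (shift_deriv t (outer_slice y1 G)) y2"
proof -
  have "outer_slice y1 (shift_outer t G) = shift_deriv t (outer_slice y1 G)"
    by (rule poly_eqI)
       (simp add: outer_slice_def shift_outer_def shift_deriv_def coeff_map_poly coeff_pderiv
         of_nat_poly)
  then show ?thesis by (simp flip: poly_outer_slice)
qed

lemma Re_shift_inner_quotient:
  assumes "nonvanishing G" "Re y1 > 0" "Re y2 > 0"
  shows "Re (bieval (shift_inner t G) y1 y2 / bieval G y1 y2) \<ge> Re t"
  using Re_shift_deriv_quotient[of "poly G [:y2:]" y1 t] assms
  by (simp add: bieval_shift_inner nonvanishing_def) (simp add: bieval_def)

lemma Re_shift_outer_quotient:
  assumes "nonvanishing G" "Re y1 > 0" "Re y2 > 0"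
  shows "Re (bieval (shift_outer t G) y1 y2 / bieval G y1 y2) \<ge> Re t"
  using Re_shift_deriv_quotient[of "outer_slice y1 G" y2 t] assms
  by (simp add: bieval_shift_outer nonvanishing_def poly_outer_slice)

lemma nonvanishing_shift_outer:
  assumes "nonvanishing G" "Re t > 0"
  shows "nonvanishing (shift_outer t G)"
  unfolding nonvanishing_def using Re_shift_outer_quotient[OF assms(1), of _ _ t] assms(2)
  by fastforce

text \<open>
  The value of the new polynomial divided by that of \<open>K = (t + \<partial>\<^sub>2) G\<close> is
  \<open>\<alpha> G/K + (t + \<partial>\<^sub>1) K / K\<close>. The first summand has nonnegative real part, being a nonnegative
  multiple of the inverse of \<open>K/G\<close>; the second has real part at least \<open>Re t\<close>.
\<close>

lemma nonvanishing_linear_factor: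
  assumes G: "nonvanishing G" and t: "Re t > 0" and "\<alpha> \<ge> 0"
  shows "nonvanishing (smult [:of_real \<alpha>:] G + shift_both t G)"
  unfolding nonvanishing_def
proof (intro allI impI)
  fix y1 y2 :: complex assume y: "Re y1 > 0" "Re y2 > 0"
  define K where "K = shift_outer t G"
  define k g where "k = bieval K y1 y2" and "g = bieval G y1 y2"
  have K: "nonvanishing K" unfolding K_def using G t by (rule nonvanishing_shift_outer)
  have "k \<noteq> 0" "g \<noteq> 0" using K G y by (auto simp: k_def g_def nonvanishing_def)
  have "Re (k / g) > 0"
    using Re_shift_outer_quotient[OF G y, of t] t by (simp add: k_def g_def K_def)
  then have "Re (inverse (k / g)) > 0"
    unfolding inverse_complex.sel by (intro divide_pos_pos) (auto simp: sum_power2_gt_zero_iff)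
  then have "Re (of_real \<alpha> * (g / k)) \<ge> 0"
    using \<open>\<alpha> \<ge> 0\<close> by (simp only: Re_complex_of_real Im_complex_of_real times_complex.sel inverse_divide) simp
  moreover have "Re (bieval (shift_inner t K) y1 y2 / k) > 0"
    using Re_shift_inner_quotient[OF K y, of t] t by (simp add: k_def)
  ultimately have "Re (of_real \<alpha> * (g / k) + bieval (shift_inner t K) y1 y2 / k) > 0"
    by simp
  also have "of_real \<alpha> * (g / k) + bieval (shift_inner t K) y1 y2 / k
      = bieval (smult [:of_real \<alpha>:] G + shift_both t G) y1 y2 / k"
    by (simp add: bieval_add bieval_smult shift_both_def add_divide_distrib g_def flip: K_def)
  finally show "bieval (smult [:of_real \<alpha>:] G + shift_both t G) y1 y2 \<noteq> 0" by auto
qed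

lemma shift_outer_add: "shift_outer t (G + H) = shift_outer t G + shift_outer t H"
  by (simp add: shift_outer_def shift_deriv_add)

lemma shift_outer_smult: "shift_outer t (smult c G) = smult c (shift_outer t G)"
  by (simp add: shift_outer_def shift_deriv_smult)

lemma shift_outer_sum:
  "shift_outer t (\<Sum>i\<in>A. smult (c i) (G i)) = (\<Sum>i\<in>A. smult (c i) (shift_outer t (G i)))"
  by (induction A rule: infinite_finite_induct)
     (simp_all add: shift_outer_add shift_outer_smult, simp_all add: shift_outer_def)

lemma shift_both_add: "shift_both t (G + H) = shift_both t G + shift_both t H"
  by (rule poly_eqI)
     (simp add: shift_both_def coeff_shift_inner shift_outer_def shift_deriv_add)

lemma shift_both_smult: "shift_both t (smult [:c:] G) = smult [:c:] (shift_both t G)"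
  by (rule poly_eqI)
     (simp add: shift_both_def coeff_shift_inner shift_outer_def shift_deriv_smult)

lemma shift_both_sum:
  "shift_both t (\<Sum>i\<in>A. smult [:c i:] (G i)) = (\<Sum>i\<in>A. smult [:c i:] (shift_both t (G i)))"
  by (induction A rule: infinite_finite_induct)
     (simp_all add: shift_both_add shift_both_smult,
      simp_all add: shift_both_def shift_inner_def shift_outer_def)

lemma smult_sum_right: "smult c (\<Sum>i\<in>A. p i) = (\<Sum>i\<in>A. smult c (p i))"
  by (induction A rule: infinite_finite_induct) (simp_all add: smult_add_right)

text \<open>The polynomial \<open>f\<close> evaluated at the operator \<open>(t + \<partial>\<^sub>1)(t + \<partial>\<^sub>2)\<close>.\<close>

definition poly_shift_both :: "complex poly \<Rightarrow> complex \<Rightarrow> complex poly poly \<Rightarrow> complex poly poly"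
  where "poly_shift_both f t G = (\<Sum>a\<le>degree f. smult [:coeff f a:] ((shift_both t ^^ a) G))"

lemma poly_shift_both_linear_factor:
  assumes "f \<noteq> 0"
  shows "poly_shift_both ([:-r, 1:] * f) t G
    = smult [:-r:] (poly_shift_both f t G) + shift_both t (poly_shift_both f t G)"
proof -
  let ?S = "\<lambda>c a. smult [:c:] ((shift_both t ^^ a) G)"
  define n where "n = degree f"
  have f: "[:-r, 1:] * f = smult (-r) f + pCons 0 f" by simp
  have "degree ([:-r, 1:] * f) = Suc n"
    unfolding n_def using assms by (rule degree_linear_mult)
  then have "poly_shift_both ([:-r, 1:] * f) t G
      = (\<Sum>a\<le>Suc n. ?S (- r * coeff f a) a + ?S (coeff (pCons 0 f) a) a)"
    unfolding poly_shift_both_def f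
    by (intro sum.cong) (auto simp flip: smult_add_left)
  also have "\<dots> = (\<Sum>a\<le>Suc n. ?S (- r * coeff f a) a) + (\<Sum>a\<le>Suc n. ?S (coeff (pCons 0 f) a) a)"
    by (rule sum.distrib)
  also have "(\<Sum>a\<le>Suc n. ?S (- r * coeff f a) a) = smult [:-r:] (poly_shift_both f t G)"
    by (simp add: poly_shift_both_def n_def coeff_eq_0 smult_sum_right mult.commute)
  also have "(\<Sum>a\<le>Suc n. ?S (coeff (pCons 0 f) a) a) = shift_both t (poly_shift_both f t G)"
    unfolding poly_shift_both_def shift_both_sum
    by (simp add: sum.atMost_Suc_shift n_def del: sum.atMost_Suc)
  finally show ?thesis .
qed

text \<open>
  Factoring \<open>f\<close> into linear factors factors the operator into steps of the form treated in
  \<open>nonvanishing_linear_factor\<close>.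
\<close>

lemma nonvanishing_poly_shift_both:
  assumes "f \<noteq> 0" and "\<And>r. poly f r = 0 \<Longrightarrow> r \<in> \<real>\<^sub>\<le>\<^sub>0"
    and "nonvanishing G" and "Re t > 0"
  shows "nonvanishing (poly_shift_both f t G)"
  using assms(1,2)
proof (induction "degree f" arbitrary: f)
  case 0
  then obtain c where "f = [:c:]" by (metis degree_0_id degree_eq_zeroE)
  with 0 \<open>nonvanishing G\<close> show ?case
    by (simp add: poly_shift_both_def nonvanishing_def bieval_smult)
next
  case (Suc n)
  then have "\<not> constant (poly f)" by (simp add: constant_degree)
  then obtain r where r: "poly f r = 0" using fundamental_theorem_of_algebra by blast
  then obtain q where f: "f = [:-r, 1:] * q" by (auto simp: poly_eq_0_iff_dvd elim: dvdE)
  have "q \<noteq> 0" using Suc.prems by (auto simp: f)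
  then have "degree q = n" using Suc.hyps(2) degree_linear_mult[of q r] unfolding f by (metis nat.inject)
  then have q: "nonvanishing (poly_shift_both q t G)"
    using \<open>q \<noteq> 0\<close> by (intro Suc.hyps Suc.prems) (auto simp: f)
  from r have "r \<in> \<real>\<^sub>\<le>\<^sub>0" by (rule Suc.prems)
  then obtain s where "r = of_real s" "s \<le> 0" by (auto elim: nonpos_Reals_cases)
  then show ?case
    using nonvanishing_linear_factor[OF q \<open>Re t > 0\<close>, of "- s"] \<open>q \<noteq> 0\<close>
    unfolding f by (subst poly_shift_both_linear_factor) auto
qed

section \<open>Kernel values as values of a differential operator\<close>

definition tensor :: "complex poly \<Rightarrow> complex poly \<Rightarrow> complex poly poly" where
  "tensor p q = map_poly (\<lambda>c. smult c p) q"

lemma bieval_tensor: "bieval (tensor p q) y1 y2 = poly p y1 * poly q y2"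
  by (induction q) (simp_all add: tensor_def bieval_def map_poly_pCons algebra_simps)

lemma shift_outer_tensor: "shift_outer t (tensor p q) = tensor p (shift_deriv t q)"
  by (rule poly_eqI)
     (simp add: tensor_def shift_outer_def shift_deriv_def coeff_map_poly coeff_pderiv
        of_nat_poly smult_add_left smult_add_right algebra_simps)

lemma shift_inner_tensor: "shift_inner t (tensor p q) = tensor (shift_deriv t p) q"
  by (rule poly_eqI)
     (simp add: coeff_shift_inner tensor_def coeff_map_poly shift_deriv_smult)

lemma shift_both_pow_tensor:
  "(shift_both t ^^ n) (tensor p q) = tensor ((shift_deriv t ^^ n) p) ((shift_deriv t ^^ n) q)"
  by (induction n) (simp_all add: shift_both_def shift_outer_tensor shift_inner_tensor)

text \<open>
  The value of \<open>(t + D)\<^sup>a y\<^sup>b\<close> at \<open>y = t\<close> is \<open>\<Sum>i. i! (a choose i) (b choose i) t\<^sup>a\<^sup>+\<^sup>b\<^sup>-\<^sup>2\<^sup>i\<close>, which is symmetric in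
  \<open>a\<close> and \<open>b\<close>. It can therefore be reduced to a polynomial in \<open>t\<^sup>2\<close> in two ways, and the kernel
  needs one for each of its factors. Multiplying by powers of \<open>t\<close> on both sides avoids negative
  exponents.
\<close>

lemma shift_deriv_pow_diagonal:
  "t ^ b * poly ((shift_deriv t ^^ a) (var ^ b)) t = t ^ a * poly (shifted_power a b) (t\<^sup>2)"
proof (induction b arbitrary: a)
  case 0
  have "(shift_deriv t ^^ a) 1 = [:t ^ a:]"
    by (induction a) (simp_all add: shift_deriv_def one_pCons)
  then show ?case by simp
next
  case (Suc b)
  have *: "of_nat a * (t ^ Suc b * poly ((shift_deriv t ^^ (a - 1)) (var ^ b)) t)
      = of_nat a * (t ^ a * poly (shifted_power (a - 1) b) (t\<^sup>2))"
  proof (cases a)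
    case (Suc c)
    then show ?thesis using Suc.IH[of c] by simp
  qed simp
  show ?case
    using Suc.IH[of a] * unfolding shifted_power_Suc_right power_Suc shift_deriv_pow_var_mult
    by (simp add: algebra_simps power2_eq_square)
qed

lemma shift_deriv_pow_diagonal':
  "t ^ a * poly ((shift_deriv t ^^ a) (var ^ b)) t = t ^ b * poly (shifted_power b a) (t\<^sup>2)"
proof (induction a arbitrary: b)
  case (Suc a)
  have "(shift_deriv t ^^ Suc a) (var ^ b)
      = smult t ((shift_deriv t ^^ a) (var ^ b)) + of_nat b * (shift_deriv t ^^ a) (var ^ (b - 1))"
    by (simp add: shift_deriv_def pderiv_shift_deriv_pow pderiv_var_power shift_deriv_pow_of_nat_mult)
  moreover have "of_nat b * (t ^ Suc a * poly ((shift_deriv t ^^ a) (var ^ (b - 1))) t)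
      = of_nat b * (t ^ b * poly (shifted_power (b - 1) a) (t\<^sup>2))"
  proof (cases b)
    case (Suc c)
    then show ?thesis using Suc.IH[of c] by simp
  qed simp
  ultimately show ?case
    using Suc.IH[of b] unfolding shifted_power_Suc_right
    by (simp add: algebra_simps power2_eq_square)
qed (simp add: power_mult[symmetric] mult.commute)

text \<open>
  The first factor contributes \<open>t\<^sup>b\<^sup>-\<^sup>a\<close> and the second \<open>t\<^sup>a\<^sup>-\<^sup>b\<close>, so that only \<open>t\<^sup>2\<close> remains.
\<close>

lemma bieval_star_kernel:
  assumes "t \<noteq> 0"
  shows "bieval (shift_outer t ((shift_both t ^^ a) (tensor (var ^ b) (var ^ Suc b)))) t t
    = poly (star_kernel a b) (t\<^sup>2)"
proof -
  define u where "u = poly ((shift_deriv t ^^ a) (var ^ b)) t"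
  define v where "v = poly ((shift_deriv t ^^ Suc a) (var ^ Suc b)) t"
  have "t ^ a * u = t ^ b * poly (shifted_power b a) (t\<^sup>2)"
    unfolding u_def by (rule shift_deriv_pow_diagonal')
  moreover have "t ^ Suc b * v = t ^ Suc a * poly (shifted_power (Suc a) (Suc b)) (t\<^sup>2)"
    unfolding v_def by (rule shift_deriv_pow_diagonal)
  ultimately have "(t ^ a * u) * (t ^ Suc b * v) = t ^ (a + Suc b) * poly (star_kernel a b) (t\<^sup>2)"
    by (simp add: star_kernel_def power_add)
  then have "t ^ (a + Suc b) * (u * v) = t ^ (a + Suc b) * poly (star_kernel a b) (t\<^sup>2)"
    by (simp add: power_add mult_ac)
  then have "u * v = poly (star_kernel a b) (t\<^sup>2)" using assms by simp
  then show ?thesis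
    by (simp add: shift_both_pow_tensor shift_outer_tensor bieval_tensor u_def v_def)
qed

definition substituted_product :: "complex poly \<Rightarrow> complex poly poly" where
  "substituted_product g = (\<Sum>b\<le>degree g. smult [:coeff g b:] (tensor (var ^ b) (var ^ Suc b)))"

lemma bieval_substituted_product: "bieval (substituted_product g) y1 y2 = y2 * poly g (y1 * y2)"
  by (simp add: substituted_product_def bieval_sum bieval_smult bieval_tensor poly_altdef[of g]
      sum_distrib_left power_mult_distrib mult_ac)

lemma mult_right_half_plane:
  assumes "Re y1 > 0" "Re y2 > 0"
  shows "y1 * y2 \<notin> \<real>\<^sub>\<le>\<^sub>0"
proof
  assume "y1 * y2 \<in> \<real>\<^sub>\<le>\<^sub>0"
  then have re: "Re y1 * Re y2 - Im y1 * Im y2 \<le> 0" and im: "Re y1 * Im y2 + Im y1 * Re y2 = 0"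
    by (simp_all add: complex_nonpos_Reals_iff)
  \<comment> \<open>Eliminate the imaginary part of \<open>y2\<close> by means of the vanishing imaginary part of the product.\<close>
  have "Re y1 * (Re y1 * Re y2 - Im y1 * Im y2)
      = ((Re y1)\<^sup>2 + (Im y1)\<^sup>2) * Re y2 - Im y1 * (Re y1 * Im y2 + Im y1 * Re y2)"
    by (simp add: algebra_simps power2_eq_square)
  also have "\<dots> > 0"
    unfolding im using assms by (simp add: add_pos_nonneg)
  finally show False using re assms(1) by (simp add: zero_less_mult_iff)
qed

lemma nonvanishing_substituted_product:
  assumes "\<And>z. poly g z = 0 \<Longrightarrow> z \<in> \<real>\<^sub>\<le>\<^sub>0"
  shows "nonvanishing (substituted_product g)"
  unfolding nonvanishing_def bieval_substituted_product
  using assms mult_right_half_plane by fastforce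

lemma shift_both_pow_sum:
  "(shift_both t ^^ n) (\<Sum>i\<in>A. smult [:c i:] (G i))
    = (\<Sum>i\<in>A. smult [:c i:] ((shift_both t ^^ n) (G i)))"
  by (induction n) (simp_all add: shift_both_sum)

text \<open>Both sides are bilinear in the coefficients, so \<open>bieval_star_kernel\<close> decides.\<close>

lemma poly_star_form:
  assumes "t \<noteq> 0"
  shows "poly (star_form f g) (t\<^sup>2)
    = bieval (shift_outer t (poly_shift_both f t (substituted_product g))) t t"
  unfolding star_form_def poly_shift_both_def substituted_product_def shift_both_pow_sum
    shift_outer_sum bieval_sum bieval_smult bieval_star_kernel[OF assms] poly_sum poly_smult ..

lemma star_form_nonvanishing:
  fixes f g :: "complex poly"
  assumes "f \<noteq> 0"
    and f: "\<And>z. poly f z = 0 \<Longrightarrow> z \<in> \<real>\<^sub>\<le>\<^sub>0" and g: "\<And>z. poly g z = 0 \<Longrightarrow> z \<in> \<real>\<^sub>\<le>\<^sub>0"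
    and "Re t > 0"
  shows "poly (star_form f g) (t\<^sup>2) \<noteq> 0"
proof -
  have "nonvanishing (shift_outer t (poly_shift_both f t (substituted_product g)))"
    using assms
    by (intro nonvanishing_shift_outer nonvanishing_poly_shift_both nonvanishing_substituted_product) auto
  moreover have "t \<noteq> 0" using \<open>Re t > 0\<close> by auto
  ultimately show ?thesis
    using \<open>Re t > 0\<close> by (simp add: poly_star_form nonvanishing_def)
qed

section \<open>Passage to complex coefficients and conclusion\<close>

lemma map_poly_of_real_smult:
  "map_poly complex_of_real (smult c p) = smult (of_real c) (map_poly of_real p)"
  by (rule poly_eqI) (simp add: coeff_map_poly)

lemma map_poly_of_real_mult:
  "map_poly complex_of_real (p * q) = map_poly of_real p * map_poly of_real q"
  by (rule poly_eqI) (simp add: coeff_map_poly coeff_mult)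

lemma map_poly_of_real_sum:
  "map_poly complex_of_real (\<Sum>i\<in>A. p i) = (\<Sum>i\<in>A. map_poly of_real (p i))"
  by (rule poly_eqI) (simp add: coeff_map_poly coeff_sum)

lemma map_poly_of_real_var: "map_poly complex_of_real var = var"
  by (simp add: var_def map_poly_pCons)

lemma map_poly_of_real_shift_deriv:
  "map_poly complex_of_real (shift_deriv 1 p) = shift_deriv 1 (map_poly of_real p)"
  by (rule poly_eqI) (simp add: shift_deriv_def coeff_map_poly coeff_pderiv)

lemma map_poly_of_real_shifted_power:
  "map_poly complex_of_real (shifted_power n m) = shifted_power n m"
proof -
  have "map_poly complex_of_real (var ^ m) = var ^ m"
    by (induction m) (simp_all add: map_poly_of_real_mult map_poly_of_real_var)
  then show ?thesis
    unfolding shifted_power_def by (induction n) (simp_all add: map_poly_of_real_shift_deriv)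
qed

lemma map_poly_of_real_star_form:
  "map_poly complex_of_real (star_form f g) = star_form (map_poly of_real f) (map_poly of_real g)"
  by (simp add: star_form_def star_kernel_def map_poly_of_real_sum map_poly_of_real_smult
      map_poly_of_real_mult map_poly_of_real_shifted_power degree_map_poly coeff_map_poly)

theorem theorem1p2:
  fixes f g :: "real poly"
  assumes "f \<noteq> 0" and "g \<noteq> 0"
    and "[:0, 1:] dvd f" and "[:0, 1:] dvd g"
    and "\<And>z :: complex. poly (map_poly of_real f) z = 0 \<Longrightarrow> z \<in> \<real>\<^sub>\<le>\<^sub>0"
    and "\<And>z :: complex. poly (map_poly of_real g) z = 0 \<Longrightarrow> z \<in> \<real>\<^sub>\<le>\<^sub>0"
  shows "\<forall>z :: complex. poly (map_poly of_real (f \<star> g)) z = 0 \<longrightarrow> z \<in> \<real>\<^sub>\<le>\<^sub>0"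
proof (intro allI impI)
  fix z :: complex
  assume z: "poly (map_poly of_real (f \<star> g)) z = 0"
  obtain f1 g1 where f: "f = var * f1" and g: "g = var * g1"
    using assms(3,4) by (auto simp: var_def elim!: dvdE)
  define F G where "F = map_poly complex_of_real f1" and "G = map_poly complex_of_real g1"
  have "F \<noteq> 0" using \<open>f \<noteq> 0\<close> by (auto simp: F_def f map_poly_eq_0_iff)
  have F: "r \<in> \<real>\<^sub>\<le>\<^sub>0" if "poly F r = 0" for r
    using assms(5)[of r] that by (simp add: f F_def map_poly_of_real_mult)
  have G: "r \<in> \<real>\<^sub>\<le>\<^sub>0" if "poly G r = 0" for r
    using assms(6)[of r] that by (simp add: g G_def map_poly_of_real_mult)
  have "r \<in> \<real>\<^sub>\<le>\<^sub>0" if "poly (star_form F G) r = 0" for r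
    using star_form_nonvanishing[OF \<open>F \<noteq> 0\<close> F G, where t = "csqrt r"] Re_csqrt_pos[of r] that
    by auto
  moreover have "map_poly of_real (f \<star> g) = var * shift_deriv 1 (star_form F G)"
    by (simp add: f g F_def G_def lah_star_eq_star_form map_poly_of_real_mult
        map_poly_of_real_var map_poly_of_real_shift_deriv map_poly_of_real_star_form)
  then have "z = 0 \<or> poly (shift_deriv 1 (star_form F G)) z = 0" using z by simp
  ultimately show "z \<in> \<real>\<^sub>\<le>\<^sub>0" using shift_deriv_nonpos_roots by auto
qed

end
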